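(* For $n=7$ and for any odd integer $n\geq 13$, the $n$-cube $Q_n$ contains four pairwise edge-disjoint symmetric chain decompositions (SCDs).
   Context: The $n$-cube $Q_n$ is the graph whose vertices are all bitstrings of length $n$, with an edge between any two bitstrings that differ in exactly one bit. The $k$th level of $Q_n$ is the set of all bitstrings of length $n$ with exactly $k$ many 1-bits. A symmetric chain in $Q_n$ is a path $(x_k,x_{k+1},\ldots,x_{n-k})$ in $Q_n$ (for some $0\leq k\leq n/2$) where $x_i$ is from level $i$ for all $k\leq i\leq n-k$ (a single vertex is allowed when $k=n-k$). A symmetric chain decomposition (SCD) of $Q_n$ is a partition of the vertices of $Q_n$ into symmetric chains. Two SCDs are edge-disjoint if the corresponding sets of paths are edge-disjoint, i.e., there are no two vertices that are consecutive in a chain of the first SCD and also consecutive in a chain of the second SCD. *)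

theory Defs
  imports Main "HOL-Library.Disjoint_Sets"
begin

definition cube_vertices :: "nat \<Rightarrow> bool list set" where
  "cube_vertices n = {x. length x = n}"

definition cube_adj :: "nat \<Rightarrow> bool list \<Rightarrow> bool list \<Rightarrow> bool" where
  "cube_adj n x y \<longleftrightarrow>
     x \<in> cube_vertices n \<and> y \<in> cube_vertices n \<and> card {i. i < n \<and> x ! i \<noteq> y ! i} = 1"

definition cube_level :: "nat \<Rightarrow> nat \<Rightarrow> bool list set" where
  "cube_level n k = {x \<in> cube_vertices n. count_list x True = k}"

definition cube_path :: "nat \<Rightarrow> bool list list \<Rightarrow> bool" where
  "cube_path n c \<longleftrightarrow>
     c \<noteq> [] \<and> set c \<subseteq> cube_vertices n \<and> distinct c \<and> successively (cube_adj n) c"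

(* The path (x_k, ..., x_{n-k}) is the list c with c ! i = x_{k+i}. *)
definition symmetric_chain :: "nat \<Rightarrow> bool list list \<Rightarrow> bool" where
  "symmetric_chain n c \<longleftrightarrow>
     cube_path n c \<and>
     (\<exists>k. 2 * k \<le> n \<and> length c = n - 2 * k + 1 \<and>
          (\<forall>i < length c. c ! i \<in> cube_level n (k + i)))"

(* A symmetric chain is determined by its vertex set, since its vertices lie on
   distinct levels; hence no two members of C share a vertex. *)
definition is_scd :: "nat \<Rightarrow> bool list list set \<Rightarrow> bool" where
  "is_scd n C \<longleftrightarrow>
     (\<forall>c \<in> C. symmetric_chain n c) \<and> partition_on (cube_vertices n) (set ` C)"

definition path_edges :: "'a list \<Rightarrow> 'a set set" where
  "path_edges c = {{c ! i, c ! Suc i} | i. Suc i < length c}"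

definition edge_disjoint :: "'a list set \<Rightarrow> 'a list set \<Rightarrow> bool" where
  "edge_disjoint C D \<longleftrightarrow> (\<Union>c\<in>C. path_edges c) \<inter> (\<Union>d\<in>D. path_edges d) = {}"

end

theory Submission
  imports Defs "HOL-Library.Multiset"
begin

text \<open>
  Four pairwise edge-disjoint SCDs are preserved by products. An SCD \<open>C\<close> of \<open>Q\<^sub>a\<close> and an SCD \<open>D\<close> of
  \<open>Q\<^sub>b\<close> cover the vertices of \<open>Q\<^sub>a\<^sub>+\<^sub>b = Q\<^sub>a \<times> Q\<^sub>b\<close> by grids \<open>c \<times> d\<close>, and every grid splits into
  symmetric chains, the hooks (\<open>is_scd_hooks\<close>). An edge of a hook moves along an edge of \<open>c\<close> while the
  \<open>Q\<^sub>b\<close>-part stands still, or along an edge of \<open>d\<close> while the \<open>Q\<^sub>a\<close>-part stands still. Hence if the \<open>C\<^sub>i\<close>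
  are pairwise edge-disjoint and the \<open>D\<^sub>i\<close> are pairwise edge-disjoint, so are the products of \<open>C\<^sub>i\<close>
  with \<open>D\<^sub>i\<close> (\<open>edge_disjoint_scds_add\<close>).

  The numbers \<open>6, 8, 10\<close> generate all even numbers from \<open>6\<close> on under addition, and an odd number
  from \<open>13\<close> on is \<open>7\<close> plus such an even number. So four edge-disjoint SCDs in dimensions \<open>6, 7, 8, 10\<close>
  suffice. These come from explicit tables, each a solution of the satisfiability problem that
  expresses its requirements. Symmetry keeps the tables short: every family is closed under
  complementing all bits, and for \<open>n = 8, 10\<close> also under swapping the bits of each pair \<open>2j, 2j+1\<close>,
  so that one SCD yields all four.

  A chain from level \<open>k\<close> to level \<open>n - k\<close> is stored as the list of the \<open>n - k\<close> bits which are set at its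
  top, ordered such that the first \<open>k\<close> are those set at its bottom and the others are listed in the
  order in which the chain sets them. For a family of such words two facts have to be computed: every
  vertex occurs exactly once in each SCD, and no edge occurs twice in the whole family. Both are
  statements about the fibres of a list of pairs over its bit-string keys, and both are checked by
  sorting the list by one bit after another (\<open>fibresD\<close>, \<open>edge_disjoint_scds_words\<close>).
\<close>

section \<open>Symmetric chains and their decompositions\<close>

lemma cube_adj_iff:
  "cube_adj n x y \<longleftrightarrow> length x = n \<and> (\<exists>i<n. y = x[i := \<not> x ! i])"
proof
  assume "cube_adj n x y"
  then have len: "length x = n" "length y = n" and "card {i. i < n \<and> x ! i \<noteq> y ! i} = 1"
    by (auto simp: cube_adj_def cube_vertices_def)
  then obtain i where i: "{i. i < n \<and> x ! i \<noteq> y ! i} = {i}" by (metis card_1_singletonE)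
  have *: "j < n \<and> x ! j \<noteq> y ! j \<longleftrightarrow> j = i" for j
    using eqset_imp_iff[OF i, of j] by simp
  have "i < n" using *[of i] by simp
  moreover have "y = x[i := \<not> x ! i]"
  proof (rule nth_equalityI)
    show "y ! j = x[i := \<not> x ! i] ! j" if "j < length y" for j
      using *[of j] that len by (cases "j = i") auto
  qed (simp add: len)
  ultimately
  show "length x = n \<and> (\<exists>i<n. y = x[i := \<not> x ! i])" using len by blast
next
  assume "length x = n \<and> (\<exists>i<n. y = x[i := \<not> x ! i])"
  then obtain i where i: "length x = n" "i < n" "y = x[i := \<not> x ! i]" by blast
  then have "{j. j < n \<and> x ! j \<noteq> y ! j} = {i}" by (auto simp: nth_list_update)
  with i show "cube_adj n x y" by (simp add: cube_adj_def cube_vertices_def)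
qed

lemma symmetric_chainI:
  assumes "2 * k \<le> n" "length c = n - 2 * k + 1"
    and lev: "\<And>i. i < length c \<Longrightarrow> c ! i \<in> cube_level n (k + i)"
    and adj: "\<And>i. Suc i < length c \<Longrightarrow> cube_adj n (c ! i) (c ! Suc i)"
  shows "symmetric_chain n c"
proof -
  have "distinct c"
    unfolding distinct_conv_nth
  proof (intro allI impI)
    fix i j assume "i < length c" "j < length c" "i \<noteq> j"
    then show "c ! i \<noteq> c ! j" using lev[of i] lev[of j] by (auto simp: cube_level_def)
  qed
  moreover have "set c \<subseteq> cube_vertices n"
    using lev by (auto simp: cube_level_def in_set_conv_nth)
  ultimately have "cube_path n c"
    using assms(2) adj by (auto simp: cube_path_def successively_conv_nth)
  with assms show ?thesis by (auto simp: symmetric_chain_def)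
qed

lemma symmetric_chain_length: "symmetric_chain n c \<Longrightarrow> x \<in> set c \<Longrightarrow> length x = n"
  by (auto simp: symmetric_chain_def cube_path_def cube_vertices_def)

lemma symmetric_chain_distinct: "symmetric_chain n c \<Longrightarrow> distinct c"
  by (simp add: symmetric_chain_def cube_path_def)

lemma symmetric_chain_adj:
  "symmetric_chain n c \<Longrightarrow> Suc i < length c \<Longrightarrow> cube_adj n (c ! i) (c ! Suc i)"
  by (auto simp: symmetric_chain_def cube_path_def successively_conv_nth)

lemma symmetric_chain_sorted:
  assumes "symmetric_chain n c"
  shows "sorted_wrt (<) (map (\<lambda>x. count_list x True) c)"
  using assms by (auto simp: symmetric_chain_def cube_level_def sorted_wrt_iff_nth_less)

lemma symmetric_chain_eqI:
  assumes "symmetric_chain n c" "symmetric_chain n d" "set c = set d"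
  shows "c = d"
proof (rule map_sorted_distinct_set_unique)
  let ?f = "\<lambda>x. count_list x True"
  have c: "sorted (map ?f c)" "distinct (map ?f c)" and d: "sorted (map ?f d)" "distinct (map ?f d)"
    using assms(1,2)[THEN symmetric_chain_sorted] by (auto simp: strict_sorted_iff)
  then show "sorted (map ?f c)" "distinct (map ?f c)" "sorted (map ?f d)" "distinct (map ?f d)"
    by blast+
  show "inj_on ?f (set c \<union> set d)" using c(2) assms(3) by (simp add: distinct_map)
qed (fact assms(3))

text \<open>
  Turns a partition into vertex sets into a unique chain through every vertex. The two agree because a
  symmetric chain lists its vertices by increasing level, so two chains with the same vertex set are
  equal.
\<close>
lemma is_scd_iff:
  "is_scd n C \<longleftrightarrow> (\<forall>c\<in>C. symmetric_chain n c) \<and>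
     (\<forall>x. length x = n \<longrightarrow> (\<exists>!c. c \<in> C \<and> x \<in> set c))" (is "?L \<longleftrightarrow> ?R")
proof
  assume L: ?L
  then have sym: "\<forall>c\<in>C. symmetric_chain n c" and part: "partition_on (cube_vertices n) (set ` C)"
    by (auto simp: is_scd_def)
  moreover have "\<exists>!c. c \<in> C \<and> x \<in> set c" if "length x = n" for x
  proof -
    have "x \<in> \<Union>(set ` C)" using part that by (auto simp: partition_on_def cube_vertices_def)
    moreover have "c = d" if "c \<in> C" "d \<in> C" "x \<in> set c" "x \<in> set d" for c d
    proof -
      have "set c = set d"
        using disjointD[OF partition_onD2[OF part], of "set c" "set d"] that by blast
      then show ?thesis using that sym symmetric_chain_eqI by blast
    qed
    ultimately show ?thesis by blast
  qed
  ultimately show ?R by blast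
next
  assume R: ?R
  then have sym: "\<And>c. c \<in> C \<Longrightarrow> symmetric_chain n c" by blast
  have "partition_on (cube_vertices n) (set ` C)"
  proof (rule partition_onI)
    show "\<Union>(set ` C) = cube_vertices n"
      using R symmetric_chain_length by (auto simp: cube_vertices_def)
    show "disjnt p q" if "p \<in> set ` C" "q \<in> set ` C" "p \<noteq> q" for p q
    proof -
      obtain c d where cd: "p = set c" "c \<in> C" "q = set d" "d \<in> C" using \<open>p \<in> _\<close> \<open>q \<in> _\<close> by blast
      have "\<exists>!c. c \<in> C \<and> x \<in> set c" if "x \<in> set c" for x
        using R symmetric_chain_length[OF sym[OF cd(2)] that] by blast
      with cd \<open>p \<noteq> q\<close> show ?thesis unfolding disjnt_iff by metis
    qed
    show "{} \<notin> set ` C"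
      using sym by (auto simp: symmetric_chain_def cube_path_def)
  qed
  with R show ?L by (simp add: is_scd_def)
qed

definition edge_disjoint_scds :: "nat \<Rightarrow> nat \<Rightarrow> bool" where
  "edge_disjoint_scds m n \<longleftrightarrow> (\<exists>S :: nat \<Rightarrow> bool list list set.
     (\<forall>i<m. is_scd n (S i)) \<and>
     (\<forall>i<m. \<forall>j<m. i \<noteq> j \<longrightarrow> edge_disjoint (S i) (S j)))"

section \<open>Decompositions of products\<close>

text \<open>
  In the grid \<open>c \<times> d\<close> the hook \<open>t\<close> runs through row \<open>t\<close> (the vertex \<open>d ! t\<close> fixed) up to column
  \<open>m = length c - 1 - t\<close> and then continues in that column. The truncated difference \<open>s - m\<close> is \<open>0\<close> on
  the row part.
\<close>
definition hook :: "bool list list \<Rightarrow> bool list list \<Rightarrow> nat \<Rightarrow> bool list list" where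
  "hook c d t = (let m = length c - 1 - t in
     map (\<lambda>s. c ! min s m @ d ! (t + (s - m))) [0..<m + length d - t])"

lemma length_hook [simp]: "length (hook c d t) = length c - 1 - t + length d - t"
  by (simp add: hook_def Let_def)

lemma nth_hook:
  "s < length (hook c d t) \<Longrightarrow>
     hook c d t ! s = c ! min s (length c - 1 - t) @ d ! (t + (s - (length c - 1 - t)))"
  by (simp add: hook_def Let_def)

text \<open>
  The cell \<open>(i, j)\<close> of the grid lies on exactly one hook, since its position determines \<open>t\<close>: cells with
  \<open>i + j < length c\<close> are on the row part of hook \<open>j\<close>, all others on the column part of hook
  \<open>length c - 1 - i\<close>.
\<close>
lemma set_hook:
  assumes "t < length c" "t < length d"
  shows "set (hook c d t) =
    {c ! i @ d ! j |i j. i < length c \<and> j < length d \<and> t = min j (length c - 1 - i)}" (is "?L = ?R")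
proof
  show "?L \<subseteq> ?R"
  proof
    fix z assume "z \<in> ?L"
    then obtain s where s: "s < length (hook c d t)" "z = hook c d t ! s"
      by (metis in_set_conv_nth)
    let ?i = "min s (length c - 1 - t)" and ?j = "t + (s - (length c - 1 - t))"
    have "?i < length c" "?j < length d" "t = min ?j (length c - 1 - ?i)"
      using assms s(1) by (auto simp: min_def)
    with s nth_hook[OF s(1)] show "z \<in> ?R" by blast
  qed
  show "?R \<subseteq> ?L"
  proof
    fix z assume "z \<in> ?R"
    then obtain i j where ij: "i < length c" "j < length d" "t = min j (length c - 1 - i)"
        "z = c ! i @ d ! j" by blast
    let ?s = "i + (j - t)"
    have s: "?s < length (hook c d t)" using assms ij by (auto simp: min_def split: if_splits)
    have "min ?s (length c - 1 - t) = i" "t + (?s - (length c - 1 - t)) = j"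
      using assms ij by (auto simp: min_def split: if_splits)
    with nth_hook[OF s] ij(4) s show "z \<in> ?L" by (metis nth_mem)
  qed
qed

lemma cube_adj_append1:
  assumes "cube_adj a x x'" "length y = b"
  shows "cube_adj (a + b) (x @ y) (x' @ y)"
proof -
  from assms(1) obtain i where "i < a" "length x = a" "x' = x[i := \<not> x ! i]"
    by (auto simp: cube_adj_iff)
  then show ?thesis
    using assms(2)
    by (auto simp: cube_adj_iff list_update_append nth_append intro!: exI[of _ i])
qed

lemma cube_adj_append2:
  assumes "length x = a" "cube_adj b y y'"
  shows "cube_adj (a + b) (x @ y) (x @ y')"
proof -
  from assms obtain i where "i < b" "length y = b" "y' = y[i := \<not> y ! i]"
    by (auto simp: cube_adj_iff)
  then show ?thesis
    using assms(1)
    by (auto simp: cube_adj_iff list_update_append nth_append intro!: exI[of _ "a + i"])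
qed

lemma hook_step:
  assumes c: "symmetric_chain a c" and d: "symmetric_chain b d"
    and t: "t < length c" "t < length d" and s: "Suc s < length (hook c d t)"
  obtains (first) i y where "Suc i < length c" "y \<in> set d"
      "hook c d t ! s = c ! i @ y" "hook c d t ! Suc s = c ! Suc i @ y"
  | (second) j x where "Suc j < length d" "x \<in> set c"
      "hook c d t ! s = x @ d ! j" "hook c d t ! Suc s = x @ d ! Suc j"
proof -
  let ?m = "length c - 1 - t"
  have s': "s < length (hook c d t)" using s by simp
  show ?thesis
  proof (cases "s < ?m")
    case True
    then have "hook c d t ! s = c ! s @ d ! t" "hook c d t ! Suc s = c ! Suc s @ d ! t"
      using nth_hook[OF s] nth_hook[OF s'] by (auto simp: min_def)
    with True t first[of s "d ! t"] show ?thesis by simp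
  next
    case False
    then have "hook c d t ! s = c ! ?m @ d ! (t + (s - ?m))"
        "hook c d t ! Suc s = c ! ?m @ d ! Suc (t + (s - ?m))"
      using nth_hook[OF s] nth_hook[OF s'] by (auto simp: min_def Suc_diff_le)
    moreover have "Suc (t + (s - ?m)) < length d" "?m < length c"
      using False s t by auto
    ultimately show ?thesis using second[of "t + (s - ?m)" "c ! ?m"] by simp
  qed
qed

text \<open>
  Every step of a hook raises the level by one. If \<open>c\<close> starts at level \<open>k\<close> and \<open>d\<close> at level \<open>l\<close>, the hook
  starts at \<open>k + l + t\<close>; it ends in the last row at column \<open>length c - 1 - t\<close>, that is at level
  \<open>(a - k - t) + (b - l)\<close>.
\<close>
lemma symmetric_chain_hook:
  assumes c: "symmetric_chain a c" and d: "symmetric_chain b d"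
    and t: "t < length c" "t < length d"
  shows "symmetric_chain (a + b) (hook c d t)"
proof -
  obtain k where k: "2 * k \<le> a" "length c = a - 2 * k + 1"
      "\<And>i. i < length c \<Longrightarrow> c ! i \<in> cube_level a (k + i)"
    using c by (auto simp: symmetric_chain_def)
  obtain l where l: "2 * l \<le> b" "length d = b - 2 * l + 1"
      "\<And>i. i < length d \<Longrightarrow> d ! i \<in> cube_level b (l + i)"
    using d by (auto simp: symmetric_chain_def)
  show ?thesis
  proof (rule symmetric_chainI)
    show "2 * (k + l + t) \<le> a + b" "length (hook c d t) = a + b - 2 * (k + l + t) + 1"
      using k l t by auto
  next
    fix s assume s: "s < length (hook c d t)"
    let ?i = "min s (length c - 1 - t)" and ?j = "t + (s - (length c - 1 - t))"
    have "?i < length c" "?j < length d" "k + ?i + (l + ?j) = k + l + t + s"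
      using t s by (auto simp: min_def)
    with k(3)[of ?i] l(3)[of ?j] show "hook c d t ! s \<in> cube_level (a + b) (k + l + t + s)"
      by (auto simp: nth_hook[OF s] cube_level_def cube_vertices_def)
  next
    fix s assume s: "Suc s < length (hook c d t)"
    show "cube_adj (a + b) (hook c d t ! s) (hook c d t ! Suc s)"
      using c d t s
    proof (cases rule: hook_step)
      case (first i y)
      then show ?thesis
        using symmetric_chain_adj[OF c] symmetric_chain_length[OF d] cube_adj_append1 by simp
    next
      case (second j x)
      then show ?thesis
        using symmetric_chain_adj[OF d] symmetric_chain_length[OF c] cube_adj_append2 by simp
    qed
  qed
qed

definition hooks :: "bool list list set \<Rightarrow> bool list list set \<Rightarrow> bool list list set" where
  "hooks C D = {hook c d t |c d t. c \<in> C \<and> d \<in> D \<and> t < length c \<and> t < length d}"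

lemma is_scd_hooks:
  assumes C: "is_scd a C" and D: "is_scd b D"
  shows "is_scd (a + b) (hooks C D)"
  unfolding is_scd_iff
proof (intro conjI ballI allI impI)
  have symC: "\<And>c. c \<in> C \<Longrightarrow> symmetric_chain a c" and symD: "\<And>d. d \<in> D \<Longrightarrow> symmetric_chain b d"
    using C D by (auto simp: is_scd_iff)
  show "symmetric_chain (a + b) h" if "h \<in> hooks C D" for h
    using that symC symD symmetric_chain_hook by (auto simp: hooks_def)
  fix z :: "bool list" assume len: "length z = a + b"
  define x y where "x = take a z" and "y = drop a z"
  have z: "z = x @ y" and lx: "length x = a" and ly: "length y = b"
    using len by (auto simp: x_def y_def)
  obtain c where c: "c \<in> C" "x \<in> set c" "\<And>c'. c' \<in> C \<Longrightarrow> x \<in> set c' \<Longrightarrow> c' = c"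
    using C lx unfolding is_scd_iff by metis
  obtain d where d: "d \<in> D" "y \<in> set d" "\<And>d'. d' \<in> D \<Longrightarrow> y \<in> set d' \<Longrightarrow> d' = d"
    using D ly unfolding is_scd_iff by metis
  obtain i where i: "i < length c" "c ! i = x" using c(2) by (auto simp: in_set_conv_nth)
  obtain j where j: "j < length d" "d ! j = y" using d(2) by (auto simp: in_set_conv_nth)
  define t where "t = min j (length c - 1 - i)"
  have t: "t < length c" "t < length d" using i j by (auto simp: t_def)
  show "\<exists>!h. h \<in> hooks C D \<and> z \<in> set h"
  proof (rule ex1I[of _ "hook c d t"], intro conjI)
    show "hook c d t \<in> hooks C D" using c(1) d(1) t by (auto simp: hooks_def)
    show "z \<in> set (hook c d t)" using i j z t by (auto simp: set_hook t_def)
  next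
    fix h assume h: "h \<in> hooks C D \<and> z \<in> set h"
    then obtain c' d' t' where h': "h = hook c' d' t'" "c' \<in> C" "d' \<in> D" "t' < length c'" "t' < length d'"
      by (auto simp: hooks_def)
    with h obtain i' j' where ij: "z = c' ! i' @ d' ! j'" "i' < length c'" "j' < length d'"
        "t' = min j' (length c' - 1 - i')"
      by (auto simp: set_hook)
    have "length (c' ! i') = a" using symC h'(2) ij(2) symmetric_chain_length nth_mem by blast
    then have xy: "c' ! i' = x" "d' ! j' = y" using ij(1) z lx by auto
    then have "c' = c" "d' = d" using c(3) d(3) h' ij nth_mem by metis+
    moreover from this xy have "i' = i" "j' = j"
      using i j ij symmetric_chain_distinct[OF symC[OF c(1)]] symmetric_chain_distinct[OF symD[OF d(1)]]
      by (auto simp: nth_eq_iff_index_eq)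
    ultimately show "h = hook c d t" using h'(1) ij(4) by (simp add: t_def)
  qed
qed

text \<open>
  The two halves of an edge of a hook show where it comes from: one half is an edge of a factor, the
  other one a single vertex. The cardinality tells which is which.
\<close>
lemma path_edges_hook:
  assumes c: "symmetric_chain a c" and d: "symmetric_chain b d"
    and t: "t < length c" "t < length d" and E: "E \<in> path_edges (hook c d t)"
  shows "take a ` E \<in> path_edges c \<and> card (drop a ` E) = 1 \<or>
         drop a ` E \<in> path_edges d \<and> card (take a ` E) = 1"
proof -
  obtain s where s: "Suc s < length (hook c d t)" and Es: "E = {hook c d t ! s, hook c d t ! Suc s}"
    using E by (auto simp: path_edges_def)
  have len: "length (c ! i) = a" if "i < length c" for i
    using that c symmetric_chain_length nth_mem by blast
  show ?thesis
    using c d t s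
  proof (cases rule: hook_step)
    case (first i y)
    then have "take a ` E = {c ! i, c ! Suc i}" "drop a ` E = {y}" using Es len by auto
    with first(1) show ?thesis by (auto simp: path_edges_def)
  next
    case (second j x)
    then have "take a ` E = {x}" "drop a ` E = {d ! j, d ! Suc j}"
      using Es symmetric_chain_length[OF c] by auto
    with second(1) show ?thesis by (auto simp: path_edges_def)
  qed
qed

lemma card_path_edge:
  "distinct c \<Longrightarrow> E \<in> path_edges c \<Longrightarrow> card E = 2"
  by (auto simp: path_edges_def nth_eq_iff_index_eq)

lemma edge_disjoint_hooks:
  assumes scd: "is_scd a C" "is_scd b D" "is_scd a C'" "is_scd b D'"
    and CC: "edge_disjoint C C'" and DD: "edge_disjoint D D'"
  shows "edge_disjoint (hooks C D) (hooks C' D')"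
proof -
  have *: "(\<exists>c\<in>C. take a ` E \<in> path_edges c) \<and> card (take a ` E) = 2 \<and> card (drop a ` E) = 1 \<or>
      (\<exists>d\<in>D. drop a ` E \<in> path_edges d) \<and> card (take a ` E) = 1"
    if scds: "is_scd a C" "is_scd b D" and h: "h \<in> hooks C D" and E: "E \<in> path_edges h" for C D h E
  proof -
    obtain c d t where cdt: "h = hook c d t" "c \<in> C" "d \<in> D" "t < length c" "t < length d"
      using h unfolding hooks_def by blast
    then have sym: "symmetric_chain a c" "symmetric_chain b d" using scds by (auto simp: is_scd_iff)
    then show ?thesis
      using path_edges_hook[OF sym cdt(4,5)] E cdt card_path_edge[OF symmetric_chain_distinct[OF sym(1)]]
      by blast
  qed
  have False if h: "h \<in> hooks C D" "E \<in> path_edges h" "h' \<in> hooks C' D'" "E \<in> path_edges h'" for h h' E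
  proof -
    have "\<not> ((\<exists>c\<in>C. take a ` E \<in> path_edges c) \<and> (\<exists>c\<in>C'. take a ` E \<in> path_edges c))"
      "\<not> ((\<exists>d\<in>D. drop a ` E \<in> path_edges d) \<and> (\<exists>d\<in>D'. drop a ` E \<in> path_edges d))"
      using CC DD unfolding edge_disjoint_def by blast+
    with *[OF scd(1,2) h(1,2)] *[OF scd(3,4) h(3,4)] show False by linarith
  qed
  then show ?thesis unfolding edge_disjoint_def by blast
qed

lemma edge_disjoint_scds_add:
  assumes "edge_disjoint_scds m a" "edge_disjoint_scds m b"
  shows "edge_disjoint_scds m (a + b)"
proof -
  from assms(1) obtain S where S: "\<forall>i<m. is_scd a (S i)"
      "\<forall>i<m. \<forall>j<m. i \<noteq> j \<longrightarrow> edge_disjoint (S i) (S j)"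
    unfolding edge_disjoint_scds_def by blast
  from assms(2) obtain T where T: "\<forall>i<m. is_scd b (T i)"
      "\<forall>i<m. \<forall>j<m. i \<noteq> j \<longrightarrow> edge_disjoint (T i) (T j)"
    unfolding edge_disjoint_scds_def by blast
  from S T show ?thesis
    unfolding edge_disjoint_scds_def
    by (intro exI[of _ "\<lambda>i. hooks (S i) (T i)"]) (auto intro!: is_scd_hooks edge_disjoint_hooks[where a = a and b = b])
qed

section \<open>Chains as words\<close>

fun walk :: "bool list \<Rightarrow> nat list \<Rightarrow> bool list list" where
  "walk x [] = [x]"
| "walk x (i # w) = x # walk (x[i := True]) w"

fun walk_steps :: "bool list \<Rightarrow> nat list \<Rightarrow> (bool list \<times> nat) list" where
  "walk_steps x [] = []"
| "walk_steps x (i # w) = (x, i) # walk_steps (x[i := True]) w"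

text \<open>
  The length \<open>n - k\<close> of a word determines the bottom level \<open>k\<close>; the bound on the length says \<open>2k \<le> n\<close>.
\<close>
definition chain_word :: "nat \<Rightarrow> nat list \<Rightarrow> bool" where
  "chain_word n w \<longleftrightarrow> distinct w \<and> list_all (\<lambda>i. i < n) w \<and> n \<le> 2 * length w"

text \<open>
  Walking along the whole word starts at the zero vertex. The first \<open>k = n - length w\<close> steps only lead to
  the bottom of the chain and are dropped.
\<close>
definition word_chain :: "nat \<Rightarrow> nat list \<Rightarrow> bool list list" where
  "word_chain n w = drop (n - length w) (walk (replicate n False) w)"

definition word_steps :: "nat \<Rightarrow> nat list \<Rightarrow> (bool list \<times> nat) list" where
  "word_steps n w = drop (n - length w) (walk_steps (replicate n False) w)"

lemma length_walk [simp]: "length (walk x w) = Suc (length w)"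
  by (induction w arbitrary: x) auto

lemma length_walk_steps [simp]: "length (walk_steps x w) = length w"
  by (induction w arbitrary: x) auto

lemma walk_steps_nth:
  "j < length w \<Longrightarrow> walk_steps x w ! j = (walk x w ! j, w ! j)"
proof (induction w arbitrary: x j)
  case (Cons i w)
  then show ?case by (cases j; cases w) auto
qed simp

lemma walk_Suc: "j < length w \<Longrightarrow> walk x w ! Suc j = (walk x w ! j)[w ! j := True]"
proof (induction w arbitrary: x j)
  case (Cons i w)
  then show ?case by (cases j; cases w) auto
qed simp

lemma count_True_set:
  "i < length x \<Longrightarrow> \<not> x ! i \<Longrightarrow> count_list (x[i := True]) True = Suc (count_list x True)"
proof (induction x arbitrary: i)
  case (Cons b x)
  then show ?case by (cases i) auto
qed simp

lemma walk_nth: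
  assumes "j \<le> length w" "distinct w" "\<forall>i\<in>set w. i < length x \<and> \<not> x ! i"
  shows "length (walk x w ! j) = length x \<and>
    (\<forall>i<length x. walk x w ! j ! i \<longleftrightarrow> x ! i \<or> i \<in> set (take j w)) \<and>
    count_list (walk x w ! j) True = count_list x True + j"
  using assms
proof (induction w arbitrary: x j)
  case (Cons i w)
  show ?case
  proof (cases j)
    case (Suc j')
    let ?x = "x[i := True]"
    have "\<forall>k\<in>set w. k < length ?x \<and> \<not> ?x ! k"
      using Cons.prems(2,3) by (metis distinct.simps(2) length_list_update list.set_intros(2) nth_list_update_neq)
    with Cons Suc have "length (walk ?x w ! j') = length ?x \<and>
        (\<forall>k<length ?x. walk ?x w ! j' ! k \<longleftrightarrow> ?x ! k \<or> k \<in> set (take j' w)) \<and>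
        count_list (walk ?x w ! j') True = count_list ?x True + j'"
      by simp
    then show ?thesis
      using Suc Cons.prems(3) by (auto simp: nth_list_update count_True_set)
  qed simp
qed simp

lemma chain_word_length: "chain_word n w \<Longrightarrow> length w \<le> n"
  unfolding chain_word_def list_all_iff
  by (metis card_lessThan card_mono distinct_card finite_lessThan lessThan_iff subsetI)

lemma word_chain_nth:
  assumes w: "chain_word n w" and j: "n - length w + i \<le> length w"
  defines "x \<equiv> word_chain n w ! i"
  shows "length x = n" "count_list x True = n - length w + i"
    and "n - length w + i < length w \<Longrightarrow>
      word_steps n w ! i = (x, w ! (n - length w + i)) \<and>
      word_chain n w ! Suc i = x[w ! (n - length w + i) := True] \<and>
      w ! (n - length w + i) < n \<and> \<not> x ! (w ! (n - length w + i))"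
proof -
  let ?k = "n - length w" and ?o = "replicate n False"
  note bits = chain_word_def list_all_iff
  have d: "distinct w" "\<forall>i\<in>set w. i < length ?o \<and> \<not> ?o ! i" using w by (auto simp: bits)
  have le: "?k \<le> length w" using j by simp
  have x: "x = walk ?o w ! (?k + i)" using le by (simp add: x_def word_chain_def)
  show "length x = n" "count_list x True = ?k + i"
    using walk_nth[OF j d] by (simp_all add: x)
  assume lt: "?k + i < length w"
  then have wn: "w ! (?k + i) < n" using d by simp
  have "w ! (?k + i) \<notin> set (take (?k + i) w)"
    using d(1) lt by (auto simp: in_set_conv_nth nth_eq_iff_index_eq)
  then have "\<not> x ! (w ! (?k + i))" using walk_nth[OF j d] wn by (simp add: x)
  then show "word_steps n w ! i = (x, w ! (?k + i)) \<and>
      word_chain n w ! Suc i = x[w ! (?k + i) := True] \<and>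
      w ! (?k + i) < n \<and> \<not> x ! (w ! (?k + i))"
    using wn lt le walk_Suc[OF lt, of ?o] walk_steps_nth[OF lt, of ?o]
    by (simp add: x word_steps_def word_chain_def)
qed

lemma symmetric_chain_word_chain:
  assumes w: "chain_word n w"
  shows "symmetric_chain n (word_chain n w)"
proof (rule symmetric_chainI[of "n - length w"])
  have len: "length w \<le> n" "n \<le> 2 * length w"
    using w chain_word_length by (auto simp: chain_word_def)
  then show "2 * (n - length w) \<le> n" "length (word_chain n w) = n - 2 * (n - length w) + 1"
    by (auto simp: word_chain_def)
  show "word_chain n w ! i \<in> cube_level n (n - length w + i)" if "i < length (word_chain n w)" for i
    using that word_chain_nth[OF w, of i] len
    by (auto simp: word_chain_def cube_level_def cube_vertices_def)
  show "cube_adj n (word_chain n w ! i) (word_chain n w ! Suc i)"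
    if "Suc i < length (word_chain n w)" for i
  proof -
    let ?x = "word_chain n w ! i" and ?j = "w ! (n - length w + i)"
    have lt: "n - length w + i < length w" using that len by (simp add: word_chain_def)
    with word_chain_nth[OF w, of i] have "length ?x = n" "?j < n"
      and "word_chain n w ! Suc i = ?x[?j := \<not> ?x ! ?j]" by auto
    then show ?thesis unfolding cube_adj_iff by blast
  qed
qed

definition step_edge :: "bool list \<times> nat \<Rightarrow> bool list set" where
  "step_edge = (\<lambda>(x, i). {x, x[i := True]})"

definition step :: "nat \<Rightarrow> bool list \<times> nat \<Rightarrow> bool" where
  "step n = (\<lambda>(x, i). length x = n \<and> i < n \<and> \<not> x ! i)"

lemma word_steps_step:
  assumes w: "chain_word n w" and s: "s \<in> set (word_steps n w)"
  shows "step n s"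
proof -
  obtain i where i: "i < length (word_steps n w)" "s = word_steps n w ! i"
    using s by (metis in_set_conv_nth)
  then have "n - length w + i < length w" by (auto simp: word_steps_def)
  with i word_chain_nth[OF w, of i] show ?thesis by (auto simp: step_def)
qed

lemma path_edges_word_chain:
  assumes w: "chain_word n w"
  shows "path_edges (word_chain n w) \<subseteq> step_edge ` set (word_steps n w)"
proof
  fix E assume "E \<in> path_edges (word_chain n w)"
  then obtain i where i: "Suc i < length (word_chain n w)"
      "E = {word_chain n w ! i, word_chain n w ! Suc i}"
    by (auto simp: path_edges_def)
  then have "n - length w + i < length w" "i < length (word_steps n w)"
    by (auto simp: word_chain_def word_steps_def)
  with i word_chain_nth[OF w, of i] show "E \<in> step_edge ` set (word_steps n w)"
    by (auto simp: step_edge_def intro!: image_eqI[OF _ nth_mem[of i]])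
qed

text \<open>
  The level tells the lower end of an edge from the upper one, so an edge determines its lower end and
  the bit that is set. This makes distinctness of steps the same as disjointness of edges.
\<close>
lemma step_edge_inj:
  assumes "step n s" "step n t" "step_edge s = step_edge t"
  shows "s = t"
proof -
  obtain x i y j where st: "s = (x, i)" "t = (y, j)" by fastforce
  have x: "length x = n" "i < n" "\<not> x ! i" and y: "length y = n" "j < n" "\<not> y ! j"
    using assms st by (auto simp: step_def)
  have "{x, x[i := True]} = {y, y[j := True]}" using assms(3) st by (simp add: step_edge_def)
  moreover have "count_list (x[i := True]) True = Suc (count_list x True)"
      "count_list (y[j := True]) True = Suc (count_list y True)"
    using x y by (simp_all add: count_True_set)
  ultimately have "x = y" "x[i := True] = y[j := True]"
    by (auto simp: doubleton_eq_iff)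
  then have "i = j" using x y by (metis nth_list_update_eq nth_list_update_neq)
  with \<open>x = y\<close> st show ?thesis by simp
qed

section \<open>Sorting by bits\<close>

text \<open>
  Asserts \<open>P\<close> for the list of values at each key of length \<open>n\<close>, up to the order of the values. This is
  radix sort: \<open>ps\<close> is distributed by the first bit of the keys over \<open>zs\<close> and \<open>os\<close>, which are then
  treated in the same way with one bit less.
\<close>
fun fibres :: "('a list \<Rightarrow> bool) \<Rightarrow> nat \<Rightarrow> (bool list \<times> 'a) list
    \<Rightarrow> (bool list \<times> 'a) list \<Rightarrow> (bool list \<times> 'a) list \<Rightarrow> bool" where
  "fibres P 0 ps zs os \<longleftrightarrow> P (map snd ps)"
| "fibres P (Suc n) [] zs os \<longleftrightarrow> fibres P n zs [] [] \<and> fibres P n os [] []"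
| "fibres P (Suc n) ((x, v) # ps) zs os \<longleftrightarrow>
     (if hd x then fibres P (Suc n) ps zs ((tl x, v) # os)
      else fibres P (Suc n) ps ((tl x, v) # zs) os)"

definition fibre :: "'k \<Rightarrow> ('k \<times> 'a) list \<Rightarrow> 'a list" where
  "fibre x ps = map snd (filter (\<lambda>p. fst p = x) ps)"

lemma fibre_simps [simp]:
  "fibre x [] = []"
  "fibre x (p # ps) = (if fst p = x then snd p # fibre x ps else fibre x ps)"
  by (auto simp: fibre_def)

text \<open>
  The invariant of the sort: what has been distributed already, with its first bit removed, still
  belongs to the fibre of the key that has this bit.
\<close>
lemma fibres_sound:
  assumes perm: "\<forall>vs ws. mset vs = mset ws \<longrightarrow> P vs \<longrightarrow> P ws"
  assumes "fibres P n ps zs os" "\<forall>p\<in>set ps. length (fst p) = n"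
    "\<forall>p\<in>set zs \<union> set os. Suc (length (fst p)) = n" "length x = n"
  shows "P (fibre x ps @ (case x of [] \<Rightarrow> [] | b # y \<Rightarrow> fibre y (if b then os else zs)))"
  using assms
proof (induction P n ps zs os arbitrary: x rule: fibres.induct)
  case (1 P ps zs os)
  then have "fibre [] ps = map snd ps" by (auto simp: fibre_def)
  with 1(2,5) show ?case by simp
next
  case (2 P n zs os)
  from "2.prems"(5) obtain b y where x: "x = b # y" "length y = n" by (cases x) auto
  have "P (fibre y zs @ (case y of [] \<Rightarrow> [] | b # z \<Rightarrow> fibre z (if b then [] else [])))"
    by (rule "2.IH"(1)[OF "2.prems"(1)]) (use "2.prems"(2-) x(2) in \<open>auto\<close>)
  moreover have "P (fibre y os @ (case y of [] \<Rightarrow> [] | b # z \<Rightarrow> fibre z (if b then [] else [])))"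
    by (rule "2.IH"(2)[OF "2.prems"(1)]) (use "2.prems"(2-) x(2) in \<open>auto\<close>)
  ultimately show ?case using x(1) by (cases y) auto
next
  case (3 P n k v ps zs os)
  from "3.prems"(5) obtain b y where x: "x = b # y" "length y = n" by (cases x) auto
  from "3.prems"(3) obtain c z where k: "k = c # z" by (cases k) auto
  show ?case
  proof (cases c)
    case True
    have *: "P (fibre x ps @ (case x of [] \<Rightarrow> [] | b # y \<Rightarrow> fibre y (if b then (tl k, v) # os else zs)))"
      by (intro "3.IH"(1)[OF _ "3.prems"(1)]) (use "3.prems"(2-) k True in \<open>auto\<close>)
    show ?thesis
      by (rule "3.prems"(1)[rule_format, OF _ *]) (use x k True in \<open>auto\<close>)
  next
    case False
    have *: "P (fibre x ps @ (case x of [] \<Rightarrow> [] | b # y \<Rightarrow> fibre y (if b then os else (tl k, v) # zs)))"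
      by (intro "3.IH"(2)[OF _ "3.prems"(1)]) (use "3.prems"(2-) k False in \<open>auto\<close>)
    show ?thesis
      by (rule "3.prems"(1)[rule_format, OF _ *]) (use x k False in \<open>auto\<close>)
  qed
qed

lemma fibresD:
  assumes "\<And>vs ws. mset vs = mset ws \<Longrightarrow> P vs \<Longrightarrow> P ws"
    and "fibres P n ps [] []" "\<And>p. p \<in> set ps \<Longrightarrow> length (fst p) = n" "length x = n"
  shows "P (fibre x ps)"
proof -
  have "P (fibre x ps @ (case x of [] \<Rightarrow> [] | b # y \<Rightarrow> fibre y (if b then [] else [])))"
  proof (rule fibres_sound)
    show "\<forall>vs ws. mset vs = mset ws \<longrightarrow> P vs \<longrightarrow> P ws" using assms(1) by blast
  qed (use assms(2-) in auto)
  then show ?thesis by (cases x) auto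
qed

lemma distinct_fibres:
  assumes "fibres distinct n ps [] []" "\<And>p. p \<in> set ps \<Longrightarrow> length (fst p) = n"
  shows "distinct ps"
proof -
  have "distinct (fibre x ps)" if "length x = n" for x
    using fibresD[OF _ assms that] mset_eq_imp_distinct_iff by blast
  then have "\<forall>p\<in>set ps. distinct (fibre (fst p) ps)" using assms(2) by blast
  then show ?thesis
  proof (induction ps)
    case (Cons p ps)
    have "p \<notin> set ps" using Cons.prems by (auto simp: fibre_def image_iff)
    moreover have "\<forall>q\<in>set ps. distinct (fibre (fst q) ps)"
      using Cons.prems by (auto split: if_splits)
    ultimately show ?case using Cons.IH by simp
  qed simp
qed

text \<open>
  In a pair \<open>(g, W)\<close> the table \<open>W\<close> is to be read after applying the symmetry \<open>g\<close> to each of its words.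
  The arguments \<open>vs\<close>, \<open>g\<close>, \<open>W\<close>, \<open>Gs\<close> and \<open>acc\<close> are the state of a loop that applies \<open>f\<close> to all words in
  turn: \<open>vs\<close> is what remains of the current output, \<open>W\<close> and \<open>Gs\<close> are still to be read, and \<open>acc\<close> is the
  output so far, in reverse. The single steps of this loop are the rules \<open>word_fibres_eval\<close>.
\<close>
definition word_fibres ::
  "('a list \<Rightarrow> bool) \<Rightarrow> nat \<Rightarrow> (nat list \<Rightarrow> (bool list \<times> 'a) list) \<Rightarrow> (bool list \<times> 'a) list \<Rightarrow>
   (nat list \<Rightarrow> nat list) \<Rightarrow> nat list list \<Rightarrow> ((nat list \<Rightarrow> nat list) \<times> nat list list) list \<Rightarrow>
   (bool list \<times> 'a) list \<Rightarrow> bool" where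
  "word_fibres P n f vs g W Gs acc \<longleftrightarrow>
     fibres P n (rev (vs @ concat (map f (map g W @ concat (map (\<lambda>(g, W). map g W) Gs)))) @ acc) [] []"

definition word_vertices :: "nat \<Rightarrow> nat list \<Rightarrow> (bool list \<times> unit) list" where
  "word_vertices n w = map (\<lambda>x. (x, ())) (word_chain n w)"

definition scd_words :: "nat \<Rightarrow> ((nat list \<Rightarrow> nat list) \<times> nat list list) list \<Rightarrow> bool" where
  "scd_words n Gs \<longleftrightarrow>
     list_all (\<lambda>(g, W). list_all (\<lambda>w. chain_word n (g w)) W \<and>
       word_fibres (\<lambda>vs. vs = [()]) n (word_vertices n) [] g W [] []) Gs"

definition step_disjoint_words :: "nat \<Rightarrow> ((nat list \<Rightarrow> nat list) \<times> nat list list) list \<Rightarrow> bool" where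
  "step_disjoint_words n Gs \<longleftrightarrow> word_fibres distinct n (word_steps n) [] id [] Gs []"

text \<open>
  A fibre \<open>[()]\<close> means that the vertex occurs exactly once in the concatenation of all chains. Hence no
  vertex is missing, and different chains are disjoint.
\<close>
lemma is_scd_words:
  assumes words: "\<And>w. w \<in> set W \<Longrightarrow> chain_word n w"
    and vert: "fibres (\<lambda>vs. vs = [()]) n (rev (concat (map (word_vertices n) W))) [] []"
  shows "is_scd n (word_chain n ` set W)"
  unfolding is_scd_iff
proof (intro conjI ballI allI impI)
  let ?X = "concat (map (word_chain n) W)" and ?ps = "rev (concat (map (word_vertices n) W))"
  show sym: "symmetric_chain n c" if "c \<in> word_chain n ` set W" for c
    using that words symmetric_chain_word_chain by blast
  have ps: "?ps = map (\<lambda>x. (x, ())) (rev ?X)"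
    by (induction W) (simp_all add: word_vertices_def rev_map)
  have len: "length x = n" if "x \<in> set ?X" for x
    using that sym symmetric_chain_length by auto
  have count: "count_list ?X x = 1" if "length x = n" for x
  proof -
    have "fibre x ?ps = [()]"
    proof (rule fibresD[where P = "\<lambda>vs. vs = [()]", OF _ vert _ that])
      show "length (fst p) = n" if "p \<in> set ?ps" for p
        using that len unfolding ps set_map set_rev by fastforce
    qed auto
    moreover have "length (fibre x (map (\<lambda>x. (x, ())) xs)) = count_list xs x" for xs
      by (induction xs) auto
    ultimately show ?thesis by (metis count_list_rev length_Cons list.size(3) One_nat_def ps)
  qed
  have dist: "distinct ?X"
  proof (rule ccontr)
    assume "\<not> distinct ?X"
    then obtain xs ys zs x where "?X = xs @ [x] @ ys @ [x] @ zs"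
      using not_distinct_decomp by blast
    moreover from this have "length x = n" using len[of x] by simp
    ultimately show False using count[of x] by simp
  qed
  fix x :: "bool list" assume "length x = n"
  then have "x \<in> set ?X" using count[of x] by (metis count_list_0_iff zero_neq_one)
  then obtain c where c: "c \<in> word_chain n ` set W" "x \<in> set c" by auto
  then show "\<exists>!c. c \<in> word_chain n ` set W \<and> x \<in> set c"
  proof (intro ex1I[of _ c])
    fix d assume "d \<in> word_chain n ` set W \<and> x \<in> set d"
    then show "d = c" using c dist unfolding distinct_concat_iff by (metis disjoint_iff list.set_map)
  qed auto
qed

lemma distinct_concat_disjoint:
  assumes "distinct (concat xss)" "i < length xss" "j < length xss" "i \<noteq> j"
  shows "set (xss ! i) \<inter> set (xss ! j) = {}"
  using assms
proof (induction xss arbitrary: i j)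
  case (Cons xs xss)
  have "set xs \<inter> set (xss ! k) = {}" if "k < length xss" for k
    using Cons.prems(1) that by (fastforce dest: nth_mem)
  with Cons show ?case by (cases i; cases j) auto
qed simp

lemma edge_disjoint_scds_words:
  assumes scd: "scd_words n Gs" and dis: "step_disjoint_words n Gs"
  shows "edge_disjoint_scds (length Gs) n"
proof -
  define Ws where "Ws = map (\<lambda>(g, W). map g W) Gs"
  define S where "S = (\<lambda>i. word_chain n ` set (Ws ! i))"
  have len: "length Ws = length Gs" by (simp add: Ws_def)
  have words: "chain_word n w" if "W \<in> set Ws" "w \<in> set W" for W w
    using that scd by (fastforce simp: Ws_def scd_words_def list_all_iff)
  have "is_scd n (S i)" if "i < length Gs" for i
    unfolding S_def
  proof (rule is_scd_words)
    show "chain_word n w" if "w \<in> set (Ws ! i)" for w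
      using that \<open>i < length Gs\<close> words len by (metis nth_mem)
    obtain g W where gW: "Gs ! i = (g, W)" by fastforce
    with that have "(g, W) \<in> set Gs" by (metis nth_mem)
    with scd have "word_fibres (\<lambda>vs. vs = [()]) n (word_vertices n) [] g W [] []"
      by (fastforce simp: scd_words_def list_all_iff)
    then show "fibres (\<lambda>vs. vs = [()]) n (rev (concat (map (word_vertices n) (Ws ! i)))) [] []"
      using that gW by (simp add: Ws_def word_fibres_def)
  qed
  moreover have "edge_disjoint (S i) (S j)" if "i < length Gs" "j < length Gs" "i \<noteq> j" for i j
  proof -
    define T where "T = map (\<lambda>W. concat (map (word_steps n) W)) Ws"
    have T: "concat T = concat (map (word_steps n) (concat Ws))"
      unfolding T_def by (induction Ws) auto
    have step: "step n s" if "W \<in> set Ws" "w \<in> set W" "s \<in> set (word_steps n w)" for W w s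
      using that words word_steps_step by blast
    have "fibres distinct n (rev (concat T)) [] []"
      using dis by (simp add: step_disjoint_words_def word_fibres_def T Ws_def)
    then have "distinct (rev (concat T))"
      by (rule distinct_fibres) (use step in \<open>fastforce simp: T step_def\<close>)
    then have dist: "set (T ! i) \<inter> set (T ! j) = {}"
      using distinct_concat_disjoint[of T i j] that len by (simp add: T_def)
    have edges: "\<exists>s. s \<in> set (T ! i) \<and> step n s \<and> E = step_edge s"
      if E: "c \<in> S i" "E \<in> path_edges c" "i < length Gs" for c E i
    proof -
      obtain w where w: "w \<in> set (Ws ! i)" "c = word_chain n w" using E by (auto simp: S_def)
      have W: "Ws ! i \<in> set Ws" using E len by simp
      then obtain s where s: "s \<in> set (word_steps n w)" "E = step_edge s"
        using E w words path_edges_word_chain by blast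
      then have "s \<in> set (T ! i)" using w(1) E(3) len by (auto simp: T_def)
      then show ?thesis using s step[OF W w(1) s(1)] by blast
    qed
    have False if "c \<in> S i" "E \<in> path_edges c" "d \<in> S j" "E \<in> path_edges d" for c d E
      using edges[OF that(1,2) \<open>i < length Gs\<close>] edges[OF that(3,4) \<open>j < length Gs\<close>]
        step_edge_inj dist by blast
    then show ?thesis unfolding edge_disjoint_def by blast
  qed
  ultimately show ?thesis unfolding edge_disjoint_scds_def by (intro exI[of _ S]) blast
qed

section \<open>Evaluation by rewriting\<close>
lemma fibres_eval:
  "fibres P 0 ps zs os \<longleftrightarrow> P (map snd ps)"
  "fibres P (Suc n) [] zs os \<longleftrightarrow> fibres P n zs [] [] \<and> fibres P n os [] []"
  "fibres P (Suc n) ((True # x, v) # ps) zs os \<longleftrightarrow> fibres P (Suc n) ps zs ((x, v) # os)"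
  "fibres P (Suc n) ((False # x, v) # ps) zs os \<longleftrightarrow> fibres P (Suc n) ps ((x, v) # zs) os"
  "fibres P (numeral k) [] zs os \<longleftrightarrow>
     fibres P (pred_numeral k) zs [] [] \<and> fibres P (pred_numeral k) os [] []"
  "fibres P (numeral k) ((True # x, v) # ps) zs os \<longleftrightarrow> fibres P (numeral k) ps zs ((x, v) # os)"
  "fibres P (numeral k) ((False # x, v) # ps) zs os \<longleftrightarrow> fibres P (numeral k) ps ((x, v) # zs) os"
  by (simp_all add: numeral_eq_Suc)

lemma word_fibres_eval:
  "word_fibres P n f [] g [] [] acc \<longleftrightarrow> fibres P n acc [] []"
  "word_fibres P n f [] g [] ((g', W) # Gs) acc \<longleftrightarrow> word_fibres P n f [] g' W Gs acc"
  "word_fibres P n f [] g (w # W) Gs acc \<longleftrightarrow> word_fibres P n f (f (g w)) g W Gs acc"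
  "word_fibres P n f (v # vs) g W Gs acc \<longleftrightarrow> word_fibres P n f vs g W Gs (v # acc)"
  by (simp_all add: word_fibres_def)

lemma list_eval:
  "(y # ys)[0 := v] = v # ys"
  "(y # ys)[Suc i := v] = y # ys[i := v]"
  "(y # ys)[numeral k := v] = y # ys[pred_numeral k := v]"
  "replicate (numeral k) v = v # replicate (pred_numeral k) v"
  "[0..<numeral k] = [0..<pred_numeral k] @ [pred_numeral k]"
  by (simp_all add: numeral_eq_Suc)

text \<open>
  As congruence rules these keep the simplifier out of the long list arguments. Otherwise it would
  traverse them again after every rewrite step, which makes the cost quadratic in the number of
  vertices. Only the key length and the output of the current word are evaluated.
\<close>
lemma lazy_cong:
  "n = n' \<Longrightarrow> fibres P n ps zs os \<longleftrightarrow> fibres P n' ps zs os"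
  "vs = vs' \<Longrightarrow> word_fibres P n f vs g W Gs acc \<longleftrightarrow> word_fibres P n f vs' g W Gs acc"
  "list_all Q xs \<longleftrightarrow> list_all Q xs"
  by simp_all

section \<open>Families in dimensions 6, 7, 8 and 10\<close>

text \<open>
  Complementing all vertices of a chain and reversing it gives a symmetric chain again. Its bottom is
  the complement of the old top, and it sets the same bits in reverse order.
\<close>
definition complement_word :: "nat \<Rightarrow> nat list \<Rightarrow> nat list" where
  "complement_word n w = filter (\<lambda>i. i \<notin> set w) [0..<n] @ rev (drop (n - length w) w)"

definition swap_pairs :: "nat \<Rightarrow> nat" where
  "swap_pairs i = (if even i then Suc i else i - 1)"

(* They would compete with fibres_eval, which avoids hd and tl by matching on the first bit. *)
declare fibres.simps [simp del]

lemmas evaluation = fibres_eval word_fibres_eval list_eval scd_words_def step_disjoint_words_def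
  chain_word_def word_chain_def word_steps_def word_vertices_def complement_word_def swap_pairs_def

text \<open>
  In dimension \<open>6\<close> the four SCDs use up all \<open>60\<close> edges between levels \<open>2\<close> and \<open>3\<close>, in dimension \<open>7\<close> all
  \<open>140\<close> edges between levels \<open>3\<close> and \<open>4\<close>. Two tables and their complements make up the family.
\<close>
definition words_6a :: "nat list list" where
  "words_6a =
  [[1,0,2,5,3,4], [0,3,1,5,4], [2,1,4,0,5], [3,2,1,5,4], [4,0,2,3,1], [5,0,2,3,4], [0,2,3,1],
   [1,3,5,4], [1,4,5,0], [1,5,2,4], [2,4,3,1], [2,5,4,0], [3,4,1,0], [3,5,2,4], [4,5,3,0],
   [0,1,4], [0,1,5], [0,3,4], [0,3,5], [0,4,5]]"

definition words_6b :: "nat list list" where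
  "words_6b =
  [[2,0,1,4,3,5], [0,1,3,2,5], [1,2,3,4,5], [3,0,2,4,5], [4,1,0,3,5], [5,2,1,0,4], [0,4,3,5],
   [0,5,3,2], [1,3,4,5], [1,5,0,4], [2,3,5,1], [2,4,1,5], [3,4,2,5], [3,5,1,0], [4,5,0,2],
   [0,2,4], [0,2,5], [1,4,5], [2,4,5], [3,4,5]]"

definition words_7a :: "nat list list" where
  "words_7a =
  [[4,0,6,1,2,3,5], [0,1,3,6,5,4], [1,2,3,0,5,4], [2,5,3,4,1,6], [3,4,6,0,2,5], [5,0,2,1,4,6],
   [6,2,1,3,0,5], [0,2,3,5,6], [0,3,5,4,2], [0,6,5,2,1], [1,3,4,0,6], [1,4,0,5,6], [1,5,3,6,2],
   [1,6,3,4,5], [2,3,4,6,1], [2,4,1,3,0], [3,5,6,2,4], [3,6,0,5,4], [4,5,1,3,0], [4,6,2,0,5],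
   [5,6,2,1,4], [0,1,2,4], [0,1,5,3], [0,1,6,5], [0,2,4,5], [0,2,6,1], [0,3,4,2], [0,4,5,6],
   [1,2,5,3], [1,4,6,2], [1,5,6,4], [2,3,6,0], [2,4,5,1], [3,4,5,6], [4,5,6,2]]"

definition words_7b :: "nat list list" where
  "words_7b =
  [[2,3,1,5,4,0,6], [0,4,1,3,5,6], [1,0,2,5,3,6], [3,0,2,1,6,4], [4,2,3,1,6,5], [5,2,0,3,4,6],
   [6,1,0,2,4,5], [0,2,4,3,6], [0,5,4,2,6], [0,6,3,2,5], [1,2,5,4,6], [1,3,0,5,6], [1,4,2,0,3],
   [1,5,0,4,2], [2,6,3,1,5], [3,4,5,0,6], [3,5,1,4,6], [3,6,1,0,4], [4,5,2,3,6], [4,6,1,0,5],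
   [5,6,1,0,2], [0,2,6,5], [0,3,4,6], [0,3,5,6], [0,4,6,2], [0,5,6,4], [1,2,6,5], [1,3,4,6],
   [1,4,5,6], [2,3,5,6], [2,4,6,1], [2,5,6,4], [3,4,6,2], [3,5,6,1], [4,5,6,3]]"

text \<open>
  In dimensions \<open>8\<close> and \<open>10\<close> there is more room, and the images of a single SCD under the group generated by
  complementation and the swap of paired bits are edge-disjoint.
\<close>
definition words_8 :: "nat list list" where
  "words_8 =
  [[3,2,1,4,5,0,6,7], [0,3,2,4,5,6,7], [1,3,0,2,5,6,7], [2,1,0,4,3,6,7], [4,1,3,5,6,7,0],
   [5,1,6,4,2,0,7], [6,4,2,5,3,1,7], [7,4,3,1,2,5,0], [0,1,6,4,5,7], [0,2,4,6,1,7],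
   [0,4,1,5,3,7], [0,5,4,3,7,6], [0,6,2,3,4,7], [0,7,4,2,5,3], [1,6,7,3,5,0], [1,7,2,3,0,4],
   [2,4,1,5,7,6], [2,5,0,6,4,7], [2,6,3,5,0,7], [2,7,3,6,1,0], [3,4,6,7,0,1], [3,5,6,4,0,1],
   [3,6,1,2,4,7], [3,7,5,2,1,0], [4,5,3,7,6,2], [5,6,0,7,1,2], [5,7,0,2,1,4], [6,7,5,1,2,3],
   [0,1,5,2,4], [0,1,7,4,6], [0,2,7,1,6], [0,3,4,6,1], [0,3,5,2,7], [0,3,6,5,7], [0,3,7,5,1],
   [0,4,6,7,2], [0,6,7,3,1], [1,2,5,6,0], [1,2,6,0,3], [1,3,5,0,6], [1,3,7,0,4], [1,4,5,7,6],
   [1,4,6,2,7], [1,4,7,2,0], [1,5,7,3,4], [2,3,4,6,7], [2,3,5,1,6], [2,4,5,3,7], [2,4,7,3,0],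
   [2,5,6,7,0], [2,5,7,4,6], [2,6,7,0,3], [3,6,7,5,2], [4,5,6,7,0], [4,5,7,0,1], [4,6,7,1,3],
   [0,1,3,4], [0,1,3,6], [0,1,5,6], [0,1,5,7], [0,1,6,7], [0,2,3,7], [0,2,4,5], [0,3,4,7],
   [0,4,5,6], [1,2,5,7], [1,2,6,7], [1,3,4,6], [1,3,5,6], [2,4,6,7]]"

definition words_10 :: "nat list list" where
  "words_10 =
  [[6,1,8,5,0,3,7,9,4,2], [0,5,4,2,1,8,9,6,7], [1,9,3,4,0,7,5,8,2], [2,8,0,4,5,6,9,3,1],
   [3,1,2,0,7,5,6,4,9], [4,8,7,3,9,1,0,2,6], [5,3,2,0,7,8,1,6,9], [7,8,0,2,3,1,4,5,6],
   [8,0,6,5,4,3,9,7,2], [9,4,5,7,6,3,1,8,2], [0,1,3,6,9,5,8,4], [0,2,1,5,7,4,6,8],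
   [0,3,7,1,6,4,9,5], [0,4,6,8,3,9,2,1], [0,6,3,2,7,9,1,5], [0,7,6,2,9,5,4,8],
   [0,9,4,7,3,5,6,2], [1,2,8,5,0,7,9,4], [1,4,0,3,7,2,6,8], [1,5,3,2,6,8,9,7],
   [1,7,5,3,4,0,2,9], [1,8,4,3,2,0,5,9], [2,3,8,4,5,1,9,7], [2,4,8,9,3,6,1,5],
   [2,5,7,6,8,9,0,1], [2,6,3,1,0,5,9,8], [2,7,8,9,0,4,5,3], [2,9,6,4,3,5,7,1],
   [3,4,9,2,0,7,1,6], [3,6,7,1,2,0,8,9], [3,7,8,0,1,6,4,9], [3,8,6,5,4,2,0,1],
   [3,9,6,7,4,2,0,8], [4,5,3,1,2,0,6,9], [4,6,1,5,7,8,0,3], [4,7,5,1,2,6,9,8],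
   [5,6,0,4,7,8,3,2], [5,7,6,0,2,8,3,9], [5,8,9,3,4,2,6,7], [5,9,7,1,0,8,4,6],
   [6,7,2,1,4,0,9,5], [6,8,4,3,2,7,5,1], [6,9,4,7,2,0,8,1], [7,9,3,0,2,1,5,8],
   [8,9,6,1,7,4,2,3], [0,1,5,4,6,8,9], [0,1,6,2,5,8,9], [0,1,7,5,3,8,9], [0,1,8,6,4,7,9],
   [0,1,9,8,7,6,3], [0,2,3,8,1,9,4], [0,2,4,6,8,1,9], [0,2,5,7,4,8,6], [0,2,6,5,3,7,9],
   [0,2,7,3,4,8,9], [0,2,9,8,3,5,7], [0,3,4,2,1,6,9], [0,3,5,4,6,9,1], [0,3,8,6,7,2,9],
   [0,3,9,2,1,4,5], [0,4,7,1,5,8,2], [0,4,8,1,3,6,5], [0,5,7,8,4,9,6], [0,5,8,1,4,3,7],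
   [0,5,9,1,3,2,8], [0,6,9,4,1,5,2], [0,7,9,1,4,8,2], [0,8,9,3,7,2,1], [1,2,4,0,6,5,8],
   [1,2,5,7,3,6,9], [1,2,6,8,0,9,3], [1,2,7,4,8,5,3], [1,2,9,4,3,5,7], [1,3,4,2,7,8,6],
   [1,3,6,4,8,7,9], [1,3,7,2,8,5,9], [1,3,8,2,6,4,0], [1,4,5,8,2,6,3], [1,4,7,3,6,5,0],
   [1,4,9,8,3,0,5], [1,5,6,2,7,9,8], [1,5,8,3,2,0,6], [1,5,9,4,3,8,7], [1,6,7,0,4,5,9],
   [1,6,9,7,0,3,5], [1,7,8,0,6,5,9], [1,7,9,2,5,0,6], [1,8,9,7,2,0,6], [2,3,4,5,0,6,9],
   [2,3,7,8,6,1,5], [2,3,9,1,7,8,6], [2,4,5,1,6,9,8], [2,4,6,3,0,8,7], [2,4,7,5,6,3,1],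
   [2,4,9,5,3,7,8], [2,5,6,3,4,1,9], [2,5,8,0,3,6,9], [2,5,9,3,0,4,7], [2,6,8,7,4,9,3],
   [2,7,9,3,4,1,6], [2,8,9,1,4,3,7], [3,4,6,5,1,8,9], [3,4,7,0,8,5,2], [3,4,8,9,6,1,0],
   [3,5,6,0,7,8,9], [3,5,7,0,4,2,6], [3,5,8,0,4,9,2], [3,5,9,7,6,1,8], [3,8,9,7,6,4,0],
   [4,5,6,8,2,7,1], [4,5,8,3,1,7,6], [4,6,7,2,0,8,1], [4,7,9,2,1,5,0], [4,8,9,5,7,2,1],
   [5,6,8,2,1,7,0], [5,6,9,7,8,3,4], [5,7,8,2,3,9,6], [6,7,8,1,5,9,4], [6,7,9,8,4,5,2],
   [7,8,9,5,3,0,4], [0,1,2,7,6,9], [0,1,2,8,4,7], [0,1,2,9,8,4], [0,1,3,5,4,6], [0,1,3,8,5,9],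
   [0,1,3,9,8,7], [0,1,4,6,3,9], [0,1,4,9,2,5], [0,1,5,6,7,2], [0,1,6,9,2,4], [0,2,4,7,1,9],
   [0,2,4,9,6,5], [0,2,5,9,1,6], [0,2,6,8,9,3], [0,2,6,9,3,1], [0,2,7,9,5,3], [0,3,4,6,7,9],
   [0,3,4,8,2,5], [0,3,4,9,5,1], [0,3,5,9,6,2], [0,3,6,7,9,5], [0,3,6,9,4,2], [0,4,5,7,9,1],
   [0,4,5,8,9,1], [0,4,5,9,2,7], [0,4,6,7,9,5], [0,4,7,8,6,9], [0,4,8,9,3,2], [0,5,6,9,2,8],
   [0,5,7,9,3,1], [0,5,8,9,1,2], [0,6,7,8,2,9], [0,6,7,9,8,3], [0,6,8,9,4,2], [0,7,8,9,5,2],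
   [1,2,4,6,3,7], [1,2,4,8,6,9], [1,2,5,9,6,3], [1,2,6,9,3,7], [1,2,7,8,6,0], [1,3,5,6,7,0],
   [1,3,5,9,7,2], [1,3,6,8,0,9], [1,3,6,9,5,8], [1,3,7,8,9,6], [1,3,7,9,4,6], [1,3,8,9,6,2],
   [1,4,6,7,9,0], [1,4,6,8,7,2], [1,4,6,9,2,7], [1,4,7,8,0,3], [1,4,7,9,8,2], [1,5,6,7,9,4],
   [1,5,6,9,0,7], [1,5,7,8,9,4], [1,5,8,9,4,6], [2,3,4,7,6,0], [2,3,5,7,4,1], [2,3,5,8,6,9],
   [2,3,6,7,9,8], [2,3,6,8,0,1], [2,3,6,9,5,7], [2,3,8,9,1,5], [2,4,5,6,0,7], [2,4,5,8,9,0],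
   [2,4,6,8,9,5], [2,4,7,8,3,9], [2,5,6,9,4,7], [2,5,7,9,8,1], [2,5,8,9,1,4], [2,6,7,9,8,1],
   [2,6,8,9,5,1], [3,4,5,7,8,9], [3,4,5,9,6,1], [3,4,6,7,8,0], [3,4,6,9,1,2], [3,4,7,9,5,1],
   [3,5,6,7,2,8], [3,5,6,9,8,4], [3,5,7,8,1,9], [3,6,7,8,1,5], [3,6,8,9,0,5], [4,5,6,7,3,0],
   [4,5,6,9,8,0], [4,5,7,8,2,3], [4,6,7,8,5,3], [4,6,8,9,1,0], [4,7,8,9,0,3], [5,6,7,8,0,9],
   [5,6,8,9,0,1], [0,1,2,3,5], [0,1,2,7,8], [0,1,2,7,9], [0,1,3,5,6], [0,1,3,7,9], [0,1,4,5,9],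
   [0,1,4,8,9], [0,1,5,7,8], [0,1,6,8,9], [0,2,4,7,8], [0,2,4,7,9], [0,2,4,8,9], [0,2,5,6,8],
   [0,2,5,7,8], [0,2,5,8,9], [0,3,5,6,8], [0,3,5,7,8], [0,3,5,8,9], [0,4,5,6,9], [0,5,6,7,9],
   [1,2,3,5,9], [1,2,4,5,9], [1,2,5,7,8], [1,2,6,7,9], [1,2,6,8,9], [1,3,4,7,8], [1,3,5,6,8],
   [1,3,5,8,9], [1,3,6,7,9], [1,4,5,6,8], [1,4,5,6,9], [1,4,5,7,8], [1,4,5,7,9], [1,5,6,8,9],
   [2,3,5,7,9], [2,3,5,8,9], [2,3,6,8,9], [2,3,7,8,9], [2,4,5,7,9], [2,4,7,8,9], [2,5,6,7,9],
   [3,5,6,7,8]]"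
definition family_6 where "family_6 =
  [(id, words_6a), (id, words_6b), (complement_word 6, words_6a), (complement_word 6, words_6b)]"

definition family_7 where "family_7 =
  [(id, words_7a), (id, words_7b), (complement_word 7, words_7a), (complement_word 7, words_7b)]"

definition family_8 where "family_8 =
  [(id, words_8), (map swap_pairs, words_8),
   (complement_word 8, words_8), (\<lambda>w. complement_word 8 (map swap_pairs w), words_8)]"

definition family_10 where "family_10 =
  [(id, words_10), (map swap_pairs, words_10),
   (complement_word 10, words_10), (\<lambda>w. complement_word 10 (map swap_pairs w), words_10)]"

lemma scd_words_6: "scd_words 6 family_6"
  unfolding family_6_def words_6a_def words_6b_def by (simp add: evaluation cong: lazy_cong)

lemma step_disjoint_words_6: "step_disjoint_words 6 family_6"
  unfolding family_6_def words_6a_def words_6b_def by (simp add: evaluation cong: lazy_cong)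

lemma scd_words_7: "scd_words 7 family_7"
  unfolding family_7_def words_7a_def words_7b_def by (simp add: evaluation cong: lazy_cong)

lemma step_disjoint_words_7: "step_disjoint_words 7 family_7"
  unfolding family_7_def words_7a_def words_7b_def by (simp add: evaluation cong: lazy_cong)

lemma scd_words_8: "scd_words 8 family_8"
  unfolding family_8_def words_8_def by (simp add: evaluation cong: lazy_cong)

lemma step_disjoint_words_8: "step_disjoint_words 8 family_8"
  unfolding family_8_def words_8_def by (simp add: evaluation cong: lazy_cong)

lemma scd_words_10: "scd_words 10 family_10"
  unfolding family_10_def words_10_def by (simp add: evaluation cong: lazy_cong)

lemma step_disjoint_words_10: "step_disjoint_words 10 family_10"
  unfolding family_10_def words_10_def by (simp add: evaluation cong: lazy_cong)

lemma edge_disjoint_scds_base: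
  assumes "n \<in> {6, 7, 8, 10}"
  shows "edge_disjoint_scds 4 n"
proof -
  have "length family_6 = 4" "length family_7 = 4" "length family_8 = 4" "length family_10 = 4"
    by (simp_all add: family_6_def family_7_def family_8_def family_10_def)
  then show ?thesis
    using assms
      edge_disjoint_scds_words[OF scd_words_6 step_disjoint_words_6]
      edge_disjoint_scds_words[OF scd_words_7 step_disjoint_words_7]
      edge_disjoint_scds_words[OF scd_words_8 step_disjoint_words_8]
      edge_disjoint_scds_words[OF scd_words_10 step_disjoint_words_10]
    by auto
qed

section \<open>All even dimensions from 6 and all odd dimensions from 13\<close>

lemma edge_disjoint_scds_even:
  "even n \<Longrightarrow> 6 \<le> n \<Longrightarrow> edge_disjoint_scds 4 n"
proof (induction n rule: less_induct)
  case (less n)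
  show ?case
  proof (cases "n < 12")
    case True
    then have "n = 6 \<or> n = 8 \<or> n = 10" using less.prems by presburger
    then show ?thesis using edge_disjoint_scds_base by auto
  next
    case False
    then have "edge_disjoint_scds 4 (n - 6)" using less by simp
    then have "edge_disjoint_scds 4 (6 + (n - 6))"
      using edge_disjoint_scds_base by (intro edge_disjoint_scds_add) auto
    with False show ?thesis by simp
  qed
qed

theorem theorem4:
  fixes n :: nat
  assumes "n = 7 \<or> (odd n \<and> n \<ge> 13)"
  shows "\<exists>S :: nat \<Rightarrow> bool list list set.
           (\<forall>i < 4. is_scd n (S i)) \<and>
           (\<forall>i < 4. \<forall>j < 4. i \<noteq> j \<longrightarrow> edge_disjoint (S i) (S j))"
proof -
  have "edge_disjoint_scds 4 n"
  proof (cases "n = 7")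
    case True
    then show ?thesis using edge_disjoint_scds_base by simp
  next
    case False
    then have "odd n" "13 \<le> n" using assms by auto
    then have "edge_disjoint_scds 4 (n - 7)"
      by (intro edge_disjoint_scds_even) auto
    then have "edge_disjoint_scds 4 (7 + (n - 7))"
      using edge_disjoint_scds_base by (intro edge_disjoint_scds_add) auto
    with \<open>13 \<le> n\<close> show ?thesis by simp
  qed
  then show ?thesis unfolding edge_disjoint_scds_def .
qed

end
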